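(* For every negative integer $-T$ (that is, for every integer $T\geq 1$) there is a Pisot number of trace $-T$ and degree at most the sum of the first $2T+4$ primes.
   Context: A Pisot number is a real algebraic integer greater than $1$ whose other conjugates over $\mathbb{Q}$ all lie in the open disc $|z|<1$. The degree and trace of an algebraic integer are the degree of its minimal polynomial over $\mathbb{Q}$ and the sum of the zeros of that minimal polynomial, respectively. *)

theory Defs
  imports
    Complex_Main
    "HOL-Library.Infinite_Set"
    "HOL-Computational_Algebra.Computational_Algebra"
begin

definition min_poly :: "'a :: field_char_0 \<Rightarrow> rat poly" where
  "min_poly x = (THE p. lead_coeff p = 1 \<and> irreducible p \<and> poly (map_poly of_rat p) x = 0)"

lemma min_poly_unique:
  fixes x :: "'a :: field_char_0"
  assumes "algebraic x"
  shows "\<exists>!p :: rat poly. lead_coeff p = 1 \<and> irreducible p \<and> poly (map_poly of_rat p) x = 0"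
proof -
  define ev :: "rat poly \<Rightarrow> 'a" where "ev p = poly (map_poly of_rat p) x" for p
  have ev_add: "ev (p + q) = ev p + ev q" for p q
  proof -
    have "map_poly of_rat (p + q) = (map_poly of_rat p + map_poly of_rat q :: 'a poly)"
      by (rule poly_eqI) (simp add: coeff_map_poly of_rat_add)
    then show ?thesis by (simp add: ev_def)
  qed
  have ev_mult: "ev (p * q) = ev p * ev q" for p q
  proof -
    have "map_poly of_rat (p * q) = (map_poly of_rat p * map_poly of_rat q :: 'a poly)"
      by (rule poly_eqI) (simp add: coeff_map_poly coeff_mult of_rat_sum of_rat_mult)
    then show ?thesis by (simp add: ev_def)
  qed
  have ev_const: "ev [:c:] = of_rat c" for c
    by (simp add: ev_def map_poly_pCons)
  obtain p0 :: "'a poly" where p0: "\<forall>i. coeff p0 i \<in> \<rat>" "p0 \<noteq> 0" "poly p0 x = 0"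
    using assms by (auto simp: algebraic_altdef)
  have "\<forall>i. \<exists>r. coeff p0 i = of_rat r" using p0(1) by (auto elim!: Rats_cases)
  then obtain f where f: "\<And>i. coeff p0 i = of_rat (f i)" by metis
  define q0 where "q0 = Poly (map f [0..<Suc (degree p0)])"
  have q0: "map_poly of_rat q0 = p0"
  proof (rule poly_eqI)
    fix i show "coeff (map_poly of_rat q0) i = coeff p0 i"
    proof (cases "i \<le> degree p0")
      case True
      then show ?thesis
        by (simp add: q0_def coeff_map_poly nth_default_def f del: upt_Suc)
    next
      case False
      then show ?thesis
        by (simp add: q0_def coeff_map_poly nth_default_def coeff_eq_0 del: upt_Suc)
    qed
  qed
  have "q0 \<noteq> 0 \<and> ev q0 = 0" using p0 q0 by (auto simp: ev_def)
  then obtain m where m: "m \<noteq> 0" "ev m = 0"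
    and min: "\<And>q. q \<noteq> 0 \<Longrightarrow> ev q = 0 \<Longrightarrow> degree m \<le> degree q"
    using ex_has_least_nat[of "\<lambda>q. q \<noteq> 0 \<and> ev q = 0" q0 degree] by blast
  define n where "n = smult (inverse (lead_coeff m)) m"
  have ev_n: "ev n = 0"
    using ev_mult[of "[:inverse (lead_coeff m):]" m] m by (simp add: n_def)
  have n0: "n \<noteq> 0" and lead_n: "lead_coeff n = 1" and deg_n: "degree n = degree m"
    using m by (auto simp: n_def)
  have dvd: "n dvd q" if "ev q = 0" for q
  proof -
    have "ev q = ev (q div n * n) + ev (q mod n)"
      using ev_add[of "q div n * n" "q mod n"] by simp
    then have "ev (q mod n) = 0" using that by (simp only: ev_mult ev_n) simp
    then have "q mod n = 0"
      using min[of "q mod n"] degree_mod_less[OF n0, of q] deg_n by fastforce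
    then show ?thesis by auto
  qed
  have not_unit: "\<not> n dvd 1"
  proof
    assume "n dvd 1"
    then obtain k where k: "1 = n * k" by (elim dvdE)
    have "ev 1 = 0" unfolding k ev_mult ev_n by simp
    then show False using ev_const[of 1] by (simp add: one_pCons)
  qed
  have irr: "irreducible n"
  proof (rule irreducibleI[OF n0 not_unit])
    fix a b assume ab: "n = a * b"
    with ev_n have "ev a = 0 \<or> ev b = 0" by (simp add: ev_mult)
    then show "a dvd 1 \<or> b dvd 1"
    proof
      assume "ev a = 0"
      then have "a * b dvd a * 1" using dvd[of a] ab by simp
      then show ?thesis using n0 ab by (simp only: dvd_mult_cancel_left) auto
    next
      assume "ev b = 0"
      then have "b * a dvd b * 1" using dvd[of b] ab by (simp add: mult.commute)
      then show ?thesis using n0 ab by (simp only: dvd_mult_cancel_left) auto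
    qed
  qed
  show ?thesis
  proof (rule ex1I[of _ n])
    show "lead_coeff n = 1 \<and> irreducible n \<and> poly (map_poly of_rat n) x = 0"
      using lead_n irr ev_n by (simp add: ev_def)
  next
    fix p assume p: "lead_coeff p = 1 \<and> irreducible p \<and> poly (map_poly of_rat p) x = 0"
    then obtain k where k: "p = n * k" using dvd[of p] by (auto simp: ev_def)
    with p not_unit have "k dvd 1" by (auto dest: irreducibleD)
    then obtain c where c: "k = [:c:]" by (auto simp: is_unit_poly_iff)
    have "lead_coeff p = lead_coeff n * lead_coeff k" unfolding k by (rule lead_coeff_mult)
    then have "c = 1" using p lead_n by (simp add: c)
    then show "p = n" by (simp add: k c)
  qed
qed

definition conjugates :: "'a :: field_char_0 \<Rightarrow> complex set" where
  "conjugates x = {z. poly (map_poly of_rat (min_poly x)) z = 0}"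

definition alg_degree :: "'a :: field_char_0 \<Rightarrow> nat" where
  "alg_degree x = degree (min_poly x)"

definition alg_trace :: "'a :: field_char_0 \<Rightarrow> complex" where
  "alg_trace x = \<Sum>\<^sub># (proots (map_poly of_rat (min_poly x)))"

definition pisot :: "real \<Rightarrow> bool" where
  "pisot \<theta> \<longleftrightarrow> algebraic_int \<theta> \<and> \<theta> > 1 \<and>
     (\<forall>z \<in> conjugates \<theta> - {complex_of_real \<theta>}. cmod z < 1)"

end

theory Submission
  imports Defs "HOL-Complex_Analysis.Complex_Analysis"
begin

text \<open>For a set \<open>A\<close> of \<open>2m\<close> primes put \<open>H(z) = \<Sum>\<^bsub>p\<in>A\<^esub> (1/2 + 1/(z^p - 1))\<close>, so that \<open>Re H\<close> vanishes on the
  unit circle and is positive outside it. Clearing denominators in \<open>z - 1 = H(z)\<close> with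
  \<open>(z - 1) \<Prod> (1 + z + \<dots> + z^(p-1))\<close> gives a monic integer polynomial: the \<open>2m\<close> cyclotomic
  factors contribute \<open>-2m\<close> to its trace, but \<open>H\<close> has only the value \<open>m\<close> at infinity, and the
  trace is \<open>2 - m\<close>. Comparing real parts shows that there are no roots on the circle.
  Outside the circle the root is unique by the Schwarz lemma, since \<open>u = 1/z\<close> is a fixed point of
  \<open>u \<mapsto> 1/(1 + H(1/u))\<close>, a self-map of the disc. A monic integer polynomial with nonzero
  constant term has a root of modulus at least 1, which yields both the existence of
  the outer root and, as this root is simple, the irreducibility of the polynomial.\<close>

section \<open>Monic integer polynomials\<close>

lemma map_poly_of_int_add:
  "map_poly of_int (p + q) = (map_poly of_int p + map_poly of_int q :: 'a::comm_ring_1 poly)"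
  by (rule poly_eqI) (simp add: coeff_map_poly)

lemma map_poly_of_int_diff:
  "map_poly of_int (p - q) = (map_poly of_int p - map_poly of_int q :: 'a::comm_ring_1 poly)"
  by (rule poly_eqI) (simp add: coeff_map_poly)

lemma map_poly_of_int_mult:
  "map_poly of_int (p * q) = (map_poly of_int p * map_poly of_int q :: 'a::comm_ring_1 poly)"
  by (rule poly_eqI) (simp add: coeff_map_poly coeff_mult)

lemma map_poly_of_int_sum:
  "map_poly of_int (\<Sum>i\<in>A. f i) = (\<Sum>i\<in>A. map_poly of_int (f i) :: 'a::comm_ring_1 poly)"
  by (induction A rule: infinite_finite_induct) (simp_all add: map_poly_of_int_add)

lemma map_poly_of_int_prod:
  "map_poly of_int (\<Prod>i\<in>A. f i) = (\<Prod>i\<in>A. map_poly of_int (f i) :: 'a::comm_ring_1 poly)"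
  by (induction A rule: infinite_finite_induct) (simp_all add: map_poly_of_int_mult)

lemma degree_map_poly_of_int [simp]:
  "degree (map_poly of_int p :: 'a::{comm_ring_1,ring_char_0} poly) = degree p"
  by (cases "p = 0") (auto intro: map_poly_degree_eq)

lemma map_poly_of_rat_of_int:
  "map_poly of_rat (map_poly of_int p) = (map_poly of_int p :: 'a::field_char_0 poly)"
  by (rule poly_eqI) (simp add: coeff_map_poly)

lemma map_poly_of_int_inject:
  "map_poly of_int p = (map_poly of_int q :: 'a::{comm_ring_1,ring_char_0} poly) \<longleftrightarrow> p = q"
  by (auto simp: poly_eq_iff coeff_map_poly)

lemma poly_map_poly_of_int_of_real:
  "poly (map_poly of_int f) (complex_of_real x) = of_real (poly (map_poly of_int f) x)"
  by (simp add: poly_altdef coeff_map_poly)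

section \<open>Gauss's lemma for monic factors\<close>

lemma clear_denominators:
  fixes p :: "rat poly"
  shows "\<exists>c q. c > 0 \<and> smult (of_int c) p = map_poly of_int q"
proof (induction p)
  case 0
  show ?case by (rule exI[of _ 1], rule exI[of _ 0]) auto
next
  case (pCons a p)
  then obtain c q where cq: "c > 0" "smult (of_int c) p = map_poly of_int q"
    by blast
  obtain n d where nd: "quotient_of a = (n, d)" by fastforce
  then have d: "d > 0" and a: "a = of_int n / of_int d"
    by (auto intro: quotient_of_denom_pos quotient_of_div)
  have "smult (of_int (d * c)) (pCons a p) = pCons (of_int (c * n)) (smult (of_int d) (smult (of_int c) p))"
    using d by (simp add: a)
  also have "\<dots> = map_poly of_int (pCons (c * n) (smult d q))"
    unfolding cq(2) by (simp add: map_poly_pCons map_poly_smult)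
  finally show ?case using d cq(1) by (meson mult_pos_pos)
qed

text \<open>Clear denominators, then divide by the content; monicity of \<open>p\<close> forces the
  scaling factor to be the leading coefficient of \<open>q\<close>.\<close>

lemma monic_primitive_multiple:
  fixes p :: "rat poly"
  assumes "lead_coeff p = 1"
  shows "\<exists>q. Polynomial.content q = 1 \<and> lead_coeff q > 0 \<and> map_poly of_int q = smult (of_int (lead_coeff q)) p"
proof -
  obtain c q where cq: "c > 0" "smult (of_int c) p = map_poly of_int q"
    using clear_denominators by blast
  have "of_int (lead_coeff q) = lead_coeff (map_poly of_int q :: rat poly)"
    by (simp add: coeff_map_poly)
  also have "\<dots> = of_int c"
    using assms unfolding cq(2)[symmetric] by (simp add: lead_coeff_smult)
  finally have lead: "lead_coeff q = c" by simp
  then have "q \<noteq> 0" using cq(1) by auto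
  then have content: "Polynomial.content q > 0"
    using content_eq_zero_iff[of q] by (metis abs_ge_zero normalize_content normalize_int_def order_le_less)
  define r where "r = primitive_part q"
  have q: "q = smult (Polynomial.content q) r" by (simp add: r_def)
  have c: "c = Polynomial.content q * lead_coeff r"
    using lead by (metis q lead_coeff_smult)
  have "smult (of_int (Polynomial.content q)) (map_poly of_int r) = (map_poly of_int q :: rat poly)"
    by (subst (2) q) (simp add: map_poly_smult)
  also have "\<dots> = smult (of_int (Polynomial.content q)) (smult (of_int (lead_coeff r)) p)"
    by (simp add: cq(2)[symmetric] c)
  finally have "map_poly of_int r = smult (of_int (lead_coeff r)) p"
    using content by (metis smult_cancel of_int_eq_0_iff less_irrefl)
  moreover have "lead_coeff r > 0"
    using c cq(1) content by (simp add: zero_less_mult_iff)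
  moreover have "Polynomial.content r = 1"
    using \<open>q \<noteq> 0\<close> by (simp add: r_def)
  ultimately show ?thesis by blast
qed

text \<open>The primitive multiples \<open>a\<close>, \<open>b\<close> of the two factors have a
  primitive product, which equals \<open>f\<close> times the product of their leading coefficients.
  That product therefore divides 1, so no scaling took place.\<close>

lemma monic_rat_factors_integral:
  fixes p q :: "rat poly" and f :: "int poly"
  assumes "map_poly of_int f = p * q" "lead_coeff f = 1" "lead_coeff p = 1" "lead_coeff q = 1"
  obtains p' q' where "p = map_poly of_int p'" "q = map_poly of_int q'" "f = p' * q'"
    "lead_coeff p' = 1" "lead_coeff q' = 1"
proof -
  obtain a where a: "Polynomial.content a = 1" "lead_coeff a > 0"
      "map_poly of_int a = smult (of_int (lead_coeff a)) p"
    using monic_primitive_multiple assms(3) by blast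
  obtain b where b: "Polynomial.content b = 1" "lead_coeff b > 0"
      "map_poly of_int b = smult (of_int (lead_coeff b)) q"
    using monic_primitive_multiple assms(4) by blast
  have "map_poly of_int (a * b) = (map_poly of_int (smult (lead_coeff a * lead_coeff b) f) :: rat poly)"
    by (simp add: map_poly_of_int_mult map_poly_smult a(3) b(3) assms(1) mult.commute)
  then have ab: "a * b = smult (lead_coeff a * lead_coeff b) f"
    by (simp only: map_poly_of_int_inject)
  then have "Polynomial.content (smult (lead_coeff a * lead_coeff b) f) = 1"
    using a(1) b(1) by (metis content_mult mult_1)
  then have "lead_coeff a * lead_coeff b dvd 1"
    by (metis content_smult dvd_triv_left normalize_dvd_iff)
  then have "lead_coeff a = 1" "lead_coeff b = 1"
    using a(2) b(2) by (auto simp: zmult_eq_1_iff)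
  then show ?thesis
    using that[of a b] a(3) b(3) ab by simp
qed

text \<open>Up to sign the constant term is the product of the roots. If all of them lay in the open
  disc, it would be an integer of modulus below 1, hence 0.\<close>

lemma ex_root_norm_ge_1:
  fixes f :: "int poly"
  assumes "lead_coeff f = 1" "coeff f 0 \<noteq> 0" "degree f > 0"
  shows "\<exists>z::complex. poly (map_poly of_int f) z = 0 \<and> cmod z \<ge> 1"
proof (rule ccontr)
  assume none: "\<not> ?thesis"
  let ?F = "map_poly of_int f :: complex poly"
  have "?F \<noteq> 0" using assms(3) by (metis degree_0 degree_map_poly_of_int less_irrefl)
  then obtain R where R: "size R = degree ?F" "?F = smult (lead_coeff ?F) (\<Prod>x\<in>#R. [:-x, 1:])"
    using alg_closed_imp_factorization by blast
  have "lead_coeff ?F = 1" using assms(1) by (simp add: coeff_map_poly)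
  then have F: "?F = (\<Prod>x\<in>#R. [:-x, 1:])" using R(2) by simp
  have "x \<in># R \<Longrightarrow> poly ?F x = 0" for x
    unfolding F by (auto simp: poly_prod_mset image_iff prod_mset_zero_iff)
  then have R1: "x \<in># R \<Longrightarrow> cmod x < 1" for x
    using none by fastforce
  have "R \<noteq> {#}" using R(1) assms(3) by auto
  have "cmod (\<Prod>x\<in>#R. -x) < 1"
    using R1 \<open>R \<noteq> {#}\<close>
  proof (induction R)
    case (add x R)
    \<comment> \<open>The empty product is 1, so only a weak bound holds for the rest; strictness
      comes from the new factor.\<close>
    have "cmod (\<Prod>x\<in>#R. -x) \<le> 1"
      using add by (cases "R = {#}") (auto intro: less_imp_le)
    moreover have "cmod x < 1" using add.prems by simp
    ultimately show ?case
      by (simp add: norm_mult) (metis mult_left_le norm_ge_zero order_le_less_trans)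
  qed simp
  moreover have "poly ?F 0 = (\<Prod>x\<in>#R. -x)"
    unfolding F by (simp add: poly_prod_mset image_mset.compositionality comp_def)
  moreover have "poly ?F 0 = of_int (coeff f 0)"
    by (simp add: poly_0_coeff_0 coeff_map_poly)
  ultimately have "cmod (of_int (coeff f 0)) < 1" by simp
  then show False using assms(2) by simp
qed

text \<open>Every nonconstant monic integer factor of \<open>f\<close> has a root of modulus at
  least 1, which can only be \<open>\<theta>\<close>. Two such factors would make
  \<open>\<theta>\<close> a multiple root, so \<open>f\<close> is irreducible over the integers and,
  by Gauss's lemma, over the rationals.\<close>

lemma pisot_criterion:
  fixes f :: "int poly" and \<theta> :: real
  assumes monic: "lead_coeff f = 1" and f0: "coeff f 0 \<noteq> 0" and \<theta>: "\<theta> > 1"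
    and root: "poly (map_poly of_int f) \<theta> = 0"
    and simple: "poly (pderiv (map_poly of_int f)) \<theta> \<noteq> 0"
    and others: "\<And>z::complex. poly (map_poly of_int f) z = 0 \<Longrightarrow> z = of_real \<theta> \<or> cmod z < 1"
  shows "pisot \<theta>" "min_poly \<theta> = map_poly of_int f"
proof -
  let ?f = "map_poly of_int f :: rat poly"
  have lead: "lead_coeff ?f = 1" using monic by (simp add: coeff_map_poly)
  have int: "algebraic_int \<theta>"
    unfolding algebraic_int_altdef_ipoly using root monic by blast
  have root_factor: "poly (map_poly of_int g) \<theta> = 0"
    if g: "lead_coeff g = 1" "degree g > 0" "f = g * h" for g h
  proof -
    have "coeff g 0 \<noteq> 0" using f0 g(3) by (auto simp: coeff_mult)
    then obtain z :: complex where z: "poly (map_poly of_int g) z = 0" "cmod z \<ge> 1"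
      using ex_root_norm_ge_1 g by blast
    then have "z = of_real \<theta>"
      using others[of z] by (simp add: g(3) map_poly_of_int_mult)
    moreover have "poly (map_poly of_int g) (of_real \<theta> :: complex) = of_real (poly (map_poly of_int g) \<theta>)"
      by (rule poly_map_poly_of_int_of_real)
    ultimately show ?thesis using z(1) by simp
  qed
  have "irreducible ?f"
  proof (rule irreducibleI)
    show "?f \<noteq> 0" using lead by auto
    have "degree f > 0"
    proof (rule ccontr)
      assume "\<not> ?thesis"
      then have "f = [:1:]" using monic by (metis degree_0_id gr0I)
      then show False using root by (simp add: map_poly_pCons)
    qed
    then show "\<not> ?f dvd 1" by (simp add: is_unit_iff_degree[OF \<open>?f \<noteq> 0\<close>])
    fix a b assume ab: "?f = a * b"
    then have "a \<noteq> 0" "b \<noteq> 0" using \<open>?f \<noteq> 0\<close> by auto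
    \<comment> \<open>Since \<open>lead_coeff a * lead_coeff b = 1\<close>, making both factors
      monic leaves the product unchanged.\<close>
    define a' b' where "a' = smult (inverse (lead_coeff a)) a" and "b' = smult (inverse (lead_coeff b)) b"
    have l: "lead_coeff a' = 1" "lead_coeff b' = 1"
      using \<open>a \<noteq> 0\<close> \<open>b \<noteq> 0\<close> by (simp_all add: a'_def b'_def)
    have "lead_coeff a * lead_coeff b = 1" using lead by (simp add: ab lead_coeff_mult)
    then have "inverse (lead_coeff a) * inverse (lead_coeff b) = 1"
      by (metis inverse_1 inverse_mult_distrib)
    then have f: "?f = a' * b'" by (simp add: ab a'_def b'_def mult.commute)
    obtain p q where pq: "a' = map_poly of_int p" "b' = map_poly of_int q" "f = p * q"
      "lead_coeff p = 1" "lead_coeff q = 1"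
      using monic_rat_factors_integral[OF f monic l] by blast
    have "degree p = 0 \<or> degree q = 0"
    proof (rule ccontr)
      assume "\<not> ?thesis"
      then have "poly (map_poly of_int p) \<theta> = 0" "poly (map_poly of_int q) \<theta> = 0"
        using root_factor[of p q] root_factor[of q p] pq by (auto simp: mult.commute)
      then show False using simple by (simp add: pq(3) map_poly_of_int_mult pderiv_mult)
    qed
    moreover have "degree p = degree a" "degree q = degree b"
      using \<open>a \<noteq> 0\<close> \<open>b \<noteq> 0\<close> pq(1,2)
      by (metis a'_def b'_def degree_map_poly_of_int degree_smult_eq inverse_zero_imp_zero leading_coeff_0_iff)+
    ultimately show "a dvd 1 \<or> b dvd 1"
      using \<open>a \<noteq> 0\<close> \<open>b \<noteq> 0\<close> by (simp add: is_unit_iff_degree)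
  qed
  then have "lead_coeff ?f = 1 \<and> irreducible ?f \<and> poly (map_poly of_rat ?f) \<theta> = 0"
    using lead root by (simp add: map_poly_of_rat_of_int)
  then show mp: "min_poly \<theta> = ?f"
    unfolding min_poly_def using int
    by (intro the1_equality min_poly_unique) auto
  show "pisot \<theta>"
    using int \<theta> others
    by (auto simp: pisot_def conjugates_def mp map_poly_of_rat_of_int)
qed

section \<open>The trace read off the reversed polynomial\<close>

lemma reflect_poly_monic_linear: "reflect_poly [:a, 1:] = [:1, a :: 'a::comm_semiring_1:]"
  by (simp add: reflect_poly_def cCons_def)

text \<open>Modulo the square of the variable, multiplying polynomials with constant term 1 adds
  their linear coefficients. This serves both the sum of the roots and the second coefficient of
  \<open>star_poly\<close>.\<close>

lemma coeff_1_prod_mset: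
  fixes f :: "'b \<Rightarrow> 'a::comm_semiring_1 poly"
  assumes "\<And>i. i \<in># A \<Longrightarrow> coeff (f i) 0 = 1"
  shows "coeff (\<Prod>i\<in>#A. f i) 0 = 1 \<and> coeff (\<Prod>i\<in>#A. f i) 1 = (\<Sum>i\<in>#A. coeff (f i) 1)"
  using assms by (induction A) (auto simp: coeff_mult coeff_1 algebra_simps)

text \<open>Reversal moves the second-highest coefficient to position 1 whatever the degree, and
  turns each factor \<open>[:-x, 1:]\<close> into \<open>[:1, -x:]\<close>.\<close>

lemma sum_proots:
  fixes p :: "complex poly"
  assumes "lead_coeff p = 1"
  shows "\<Sum>\<^sub># (proots p) = - coeff (reflect_poly p) 1"
proof -
  have "p \<noteq> 0" using assms by auto
  then obtain R where R: "p = (\<Prod>x\<in>#R. [:-x, 1:])"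
    using alg_closed_imp_factorization[of p] assms by auto
  have "(\<Prod>x\<in>#M. [:-x, 1:]) \<noteq> (0 :: complex poly)" for M
    by (induction M) (auto simp del: mult_pCons_left)
  then have "proots p = R"
    unfolding R by (induction R) (auto simp: proots_mult simp del: mult_pCons_left)
  moreover have "reflect_poly p = (\<Prod>x\<in>#R. [:1, -x:])"
    unfolding R by (induction R) (auto simp: reflect_poly_mult reflect_poly_monic_linear simp del: mult_pCons_left)
  moreover have "(\<Sum>x\<in>#R. - x) = - \<Sum>\<^sub># R"
    by (induction R) auto
  ultimately show ?thesis
    using coeff_1_prod_mset[of R "\<lambda>x. [:1, -x:]"] by simp
qed

section \<open>Uniqueness of fixed points in the disc\<close>

text \<open>Conjugation by the Moebius map taking \<open>a\<close> to 0 gives a self-map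
  \<open>g\<close> fixing 0 and a second point. The equality case of the Schwarz lemma makes
  \<open>g\<close> a rotation, and the second fixed point makes it trivial.\<close>

lemma two_fixed_points_imp_id:
  assumes holo: "f holomorphic_on ball 0 1" and disc: "\<And>z. cmod z < 1 \<Longrightarrow> cmod (f z) < 1"
    and fixpt: "f a = a" "f b = b" and ab: "a \<noteq> b" "cmod a < 1" "cmod b < 1" and z: "cmod z < 1"
  shows "f z = z"
proof -
  let ?\<phi> = "Moebius_function 0 a" and ?\<psi> = "Moebius_function 0 (- a)"
  have \<psi>\<phi>: "?\<psi> (?\<phi> w) = w" if "cmod w < 1" for w
    using Moebius_function_compose[of "-a" a w] ab that by simp
  have \<phi>1: "cmod (?\<phi> w) < 1" and \<psi>1: "cmod (?\<psi> w) < 1" if "cmod w < 1" for w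
    using Moebius_function_norm_lt_1 ab that by auto
  define g where "g = ?\<phi> \<circ> (f \<circ> ?\<psi>)"
  have hg: "g holomorphic_on ball 0 1"
    unfolding g_def
    using ab disc \<psi>1
    by (intro holomorphic_on_compose_gen[where t = "ball 0 1"] Moebius_function_holomorphic holo)
       (simp_all add: image_subset_iff)
  have g0: "g 0 = 0"
    using fixpt by (simp add: g_def Moebius_function_of_zero Moebius_function_eq_zero)
  have g1: "cmod (g w) < 1" if "cmod w < 1" for w
    using that by (simp add: g_def \<phi>1 \<psi>1 disc)
  have gb: "g (?\<phi> b) = ?\<phi> b" by (simp add: g_def \<psi>\<phi> fixpt ab)
  have b0: "?\<phi> b \<noteq> 0"
    using \<psi>\<phi>[of b] ab by (auto simp: Moebius_function_of_zero)
  have "\<exists>w. cmod w < 1 \<and> w \<noteq> 0 \<and> cmod (g w) = cmod w"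
    using gb b0 \<phi>1[OF ab(3)] by (intro exI[of _ "?\<phi> b"]) simp
  then have "\<exists>\<alpha>. (\<forall>w. cmod w < 1 \<longrightarrow> g w = \<alpha> * w) \<and> cmod \<alpha> = 1"
    by (intro Schwarz_Lemma(3)[OF hg g0 g1, of 0] disjI1) simp_all
  then obtain \<alpha> where \<alpha>: "\<And>w. cmod w < 1 \<Longrightarrow> g w = \<alpha> * w" by blast
  then have "\<alpha> = 1" using gb b0 \<phi>1[OF ab(3)] by simp
  then have "g (?\<phi> z) = ?\<phi> z" using \<alpha> \<phi>1[OF z] by simp
  then have "?\<phi> (f z) = ?\<phi> z" by (simp add: g_def \<psi>\<phi> z)
  then have "?\<psi> (?\<phi> (f z)) = ?\<psi> (?\<phi> z)" by simp
  then show ?thesis by (simp only: \<psi>\<phi> z disc)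
qed

section \<open>The polynomial attached to a set of primes\<close>

text \<open>For prime \<open>n\<close> this is the cyclotomic polynomial of order
  \<open>n\<close>.\<close>

definition geo_poly :: "nat \<Rightarrow> int poly" where
  "geo_poly n = (\<Sum>k<n. monom 1 k)"

text \<open>The equation \<open>z - 1 = star_fun A z\<close> with its denominators cleared. For even
  \<open>card A\<close> the halves in \<open>star_fun\<close> add up to the integer
  \<open>card A div 2\<close>, which keeps the coefficients integral.\<close>

definition star_poly :: "nat set \<Rightarrow> int poly" where
  "star_poly A = [:- (1 + int (card A div 2)), 1:] * [:-1, 1:] * (\<Prod>p\<in>A. geo_poly p)
     - (\<Sum>p\<in>A. \<Prod>q\<in>A - {p}. geo_poly q)"

text \<open>Polymorphic because roots are located over the complex numbers, while simplicity of the
  outer root is shown over the reals.\<close>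

definition star_fun :: "nat set \<Rightarrow> 'a::field \<Rightarrow> 'a" where
  "star_fun A z = (\<Sum>p\<in>A. 1 / 2 + 1 / (z ^ p - 1))"

section \<open>Degree and extreme coefficients\<close>

lemma coeff_geo_poly: "coeff (geo_poly n) k = (if k < n then 1 else 0)"
  by (simp add: geo_poly_def coeff_sum)

lemma degree_geo_poly: "degree (geo_poly n) = n - 1"
  by (cases n) (auto intro!: antisym degree_le le_degree simp: coeff_geo_poly)

lemma lead_coeff_geo_poly: "n > 0 \<Longrightarrow> lead_coeff (geo_poly n) = 1"
  by (simp add: degree_geo_poly coeff_geo_poly)

lemma poly_geo_poly:
  "poly (map_poly of_int (geo_poly n)) z = (\<Sum>k<n. (z::'a::comm_ring_1) ^ k)"
  by (simp add: geo_poly_def map_poly_of_int_sum map_poly_monom poly_sum poly_monom)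

lemma poly_star_poly:
  "poly (map_poly of_int (star_poly A)) (z::'a::comm_ring_1) =
     (z - 1 - of_nat (card A div 2)) * (z - 1) * (\<Prod>p\<in>A. \<Sum>k<p. z ^ k)
     - (\<Sum>p\<in>A. \<Prod>q\<in>A - {p}. \<Sum>k<q. z ^ k)"
  unfolding star_poly_def
  by (simp add: map_poly_of_int_diff map_poly_of_int_mult map_poly_of_int_sum map_poly_of_int_prod
      poly_sum poly_prod poly_geo_poly map_poly_pCons algebra_simps del: mult_pCons_left mult_pCons_right)

text \<open>The subtracted sum \<open>R\<close> has degree at least 2 below that of the product
  \<open>Q\<close>, so the top two coefficients come from \<open>Q\<close> alone. For
  \<open>Q\<close> they are found factor by factor after reversal.\<close>

lemma star_poly_degree_coeff:
  assumes fin: "finite A" and ge2: "\<And>p. p \<in> A \<Longrightarrow> p \<ge> 2"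
  shows "degree (star_poly A) = 2 + (\<Sum>p\<in>A. p - 1)" (is ?deg)
    and "lead_coeff (star_poly A) = 1" (is ?lead)
    and "coeff (reflect_poly (star_poly A)) 1 = int (card A) - 2 - int (card A div 2)" (is ?second)
proof -
  let ?l = "\<lambda>c. [:c, 1:] :: int poly"
  define c where "c = - (1 + int (card A div 2))"
  define Q where "Q = ?l c * ?l (-1) * (\<Prod>p\<in>A. geo_poly p)"
  define R where "R = (\<Sum>p\<in>A. \<Prod>q\<in>A - {p}. geo_poly q)"
  have geo1: "lead_coeff (geo_poly p) = 1" if "p \<in> A" for p
    using ge2[OF that] by (intro lead_coeff_geo_poly) auto
  then have geo0: "geo_poly p \<noteq> 0" if "p \<in> A" for p
    using that by fastforce
  have deg_prod: "degree (\<Prod>p\<in>B. geo_poly p) = (\<Sum>p\<in>B. p - 1)" if "B \<subseteq> A" for B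
    using that geo0 by (subst degree_prod_eq_sum_degree) (auto simp: degree_geo_poly)
  have lead_prod: "lead_coeff (\<Prod>p\<in>A. geo_poly p) = 1"
    by (simp add: lead_coeff_prod geo1)
  have lQ: "lead_coeff Q = 1"
    unfolding Q_def lead_coeff_mult lead_prod by simp
  have P0: "(\<Prod>p\<in>A. geo_poly p) \<noteq> 0" using lead_prod by force
  have dQ: "degree Q = 2 + (\<Sum>p\<in>A. p - 1)"
    unfolding Q_def using P0 deg_prod[of A]
    by (simp add: degree_mult_eq del: mult_pCons_left mult_pCons_right)
  have dR: "degree R \<le> (\<Sum>p\<in>A. p - 1)"
    unfolding R_def
  proof (rule degree_sum_le[OF fin])
    fix p assume "p \<in> A"
    show "degree (\<Prod>q\<in>A - {p}. geo_poly q) \<le> (\<Sum>p\<in>A. p - 1)"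
      using fin by (subst deg_prod) (auto intro: sum_mono2)
  qed
  have F: "star_poly A = Q - R" by (simp add: star_poly_def Q_def R_def c_def)
  have coF: "coeff (star_poly A) k = coeff Q k" if "k > (\<Sum>p\<in>A. p - 1)" for k
    using dR that by (simp add: F coeff_eq_0)
  have dF: "degree (star_poly A) = degree Q"
    unfolding F using dR dQ by (simp add: degree_add_eq_left[of "-R" Q, simplified])
  then show ?deg using dQ by simp
  show ?lead using lQ by (simp add: dF coF dQ)
  have "coeff (reflect_poly (star_poly A)) 1 = coeff (reflect_poly Q) 1"
    by (simp add: coeff_reflect_poly dF dQ coF)
  also have "reflect_poly Q = [:1, c:] * [:1, -1:] * (\<Prod>p\<in>A. reflect_poly (geo_poly p))"
    by (simp add: Q_def reflect_poly_mult reflect_poly_prod reflect_poly_monic_linear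
         del: mult_pCons_left mult_pCons_right)
  also have "coeff \<dots> 1 = c - 1 + int (card A)"
  proof -
    \<comment> \<open>The linear coefficient is 1 only because \<open>p\<close> is at least 2, so
      that \<open>geo_poly p\<close> is not constant.\<close>
    have "coeff (reflect_poly (geo_poly p)) 0 = 1" "coeff (reflect_poly (geo_poly p)) 1 = 1"
      if "p \<in> A" for p
      using ge2[OF that] geo1[OF that] by (auto simp: coeff_reflect_poly degree_geo_poly coeff_geo_poly)
    then have "coeff (\<Prod>p\<in>A. reflect_poly (geo_poly p)) 0 = 1"
      "coeff (\<Prod>p\<in>A. reflect_poly (geo_poly p)) 1 = int (card A)"
      using coeff_1_prod_mset[of "mset_set A" "\<lambda>p. reflect_poly (geo_poly p)"] fin
      by (simp_all add: prod_unfold_prod_mset flip: sum_unfold_sum_mset)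
    then show ?thesis by (simp add: coeff_mult)
  qed
  finally show ?second by (simp add: c_def)
qed

text \<open>For \<open>card A = 2 * m\<close> the value is \<open>1 - m\<close>, nonzero once there
  are more than two primes; this feeds \<open>ex_root_norm_ge_1\<close> and
  \<open>pisot_criterion\<close>.\<close>

lemma coeff_0_star_poly:
  assumes "\<And>p. p \<in> A \<Longrightarrow> p > 0"
  shows "coeff (star_poly A) 0 = 1 + int (card A div 2) - int (card A)"
proof -
  have "coeff (geo_poly p) 0 = 1" if "p \<in> A" for p
    using assms that by (simp add: coeff_geo_poly)
  then show ?thesis
    by (simp add: star_poly_def poly_prod poly_sum flip: poly_0_coeff_0)
qed

text \<open>By the geometric sum, omitting the factor of \<open>p\<close> multiplies the full
  product by \<open>(z - 1) / (z ^ p - 1)\<close>.\<close>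

lemma star_poly_factor:
  fixes z :: "'a::field_char_0"
  assumes "finite A" "even (card A)" "z \<noteq> 1" "\<And>p. p \<in> A \<Longrightarrow> z ^ p \<noteq> 1"
  shows "poly (map_poly of_int (star_poly A)) z =
    (z - 1) * (\<Prod>p\<in>A. \<Sum>k<p. z ^ k) * (z - 1 - star_fun A z)"
proof -
  let ?S = "\<lambda>p. \<Sum>k<p. z ^ k"
  have S: "?S p = (z ^ p - 1) / (z - 1)" for p
    using assms(3) by (rule geometric_sum)
  have "(\<Prod>q\<in>A - {p}. ?S q) = prod ?S A * ((z - 1) * (1 / (z ^ p - 1)))" if "p \<in> A" for p
  proof -
    have "prod ?S A = ?S p * (\<Prod>q\<in>A - {p}. ?S q)"
      using assms(1) that by (rule prod.remove)
    then show ?thesis using assms(3,4) that by (simp add: S)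
  qed
  then have 1: "(\<Sum>p\<in>A. \<Prod>q\<in>A - {p}. ?S q) = prod ?S A * ((z - 1) * (\<Sum>p\<in>A. 1 / (z ^ p - 1)))"
    by (simp add: sum_distrib_left)
  have 2: "star_fun A z = of_nat (card A div 2) + (\<Sum>p\<in>A. 1 / (z ^ p - 1))"
    using assms(2) by (auto simp: star_fun_def sum.distrib elim!: evenE)
  show ?thesis
    unfolding poly_star_poly 1 2 by (simp add: algebra_simps)
qed

section \<open>Real parts and the unit circle\<close>

lemma Re_star_fun_term:
  assumes "w \<noteq> 1"
  shows "Re (1 / 2 + 1 / (w - 1)) = ((cmod w)\<^sup>2 - 1) / (2 * (cmod (w - 1))\<^sup>2)"
proof -
  \<comment> \<open>Half of a Cayley transform, which maps the unit circle to the imaginary axis and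
    its exterior to the right half-plane.\<close>
  have "1 / 2 + 1 / (w - 1) = (w + 1) / (2 * (w - 1))"
    using assms by (simp add: field_simps)
  also have "Re \<dots> = ((cmod w)\<^sup>2 - 1) / (2 * (cmod (w - 1))\<^sup>2)"
    using assms
    by (simp add: Re_divide cmod_def power2_eq_square add_nonneg_nonneg divide_simps) (auto simp: algebra_simps complex_eq_iff)
  finally show ?thesis .
qed

lemma Re_star_fun_pos:
  assumes "finite A" "A \<noteq> {}" "\<And>p. p \<in> A \<Longrightarrow> p > 0" "cmod z > 1"
  shows "Re (star_fun A z) > 0"
  unfolding star_fun_def Re_sum
proof (rule sum_pos)
  fix p assume "p \<in> A"
  then have p: "cmod (z ^ p) > 1" using assms by (simp add: norm_power one_less_power)
  then have "z ^ p \<noteq> 1" by auto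
  moreover have "(cmod (z ^ p))\<^sup>2 > 1" using p by (simp add: one_less_power)
  ultimately show "Re (1 / 2 + 1 / (z ^ p - 1)) > 0"
    by (simp add: Re_star_fun_term del: Re_sum plus_complex.sel)
qed (use assms in auto)

lemma star_poly_no_root_on_circle:
  assumes fin: "finite A" and ev: "even (card A)" and ne: "A \<noteq> {}"
    and prime: "\<And>p. p \<in> A \<Longrightarrow> prime p" and z: "cmod z = 1"
  shows "poly (map_poly of_int (star_poly A)) z \<noteq> 0"
proof -
  let ?S = "\<lambda>p z. \<Sum>k<p. (z::complex) ^ k"
  consider (one) "z = 1" | (pole) p where "z \<noteq> 1" "p \<in> A" "z ^ p = 1"
    | (reg) "z \<noteq> 1" "\<And>p. p \<in> A \<Longrightarrow> z ^ p \<noteq> 1" by blast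
  then show ?thesis
  proof cases
    case one
    \<comment> \<open>At 1 the first product vanishes and each geometric sum equals its number of
      terms.\<close>
    have "poly (map_poly of_int (star_poly A)) z = - of_nat (\<Sum>p\<in>A. \<Prod>q\<in>A - {p}. q)"
      by (simp add: poly_star_poly one)
    moreover have "(\<Sum>p\<in>A. \<Prod>q\<in>A - {p}. q) > 0"
      using fin ne prime by (intro sum_pos prod_pos) (auto simp: prime_gt_0_nat)
    ultimately show ?thesis by (metis neg_equal_0_iff_equal of_nat_eq_0_iff less_irrefl)
  next
    case pole
    have S: "?S q z = (z ^ q - 1) / (z - 1)" for q
      using pole(1) by (rule geometric_sum)
    \<comment> \<open>By Bezout for the coprime exponents, a common root of unity would be
      1.\<close>
    have zq: "z ^ q \<noteq> 1" if qA: "q \<in> A" "q \<noteq> p" for q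
    proof
      assume q: "z ^ q = 1"
      have "coprime p q" using prime pole(2) qA by (simp add: primes_coprime)
      moreover have "q \<noteq> 1" using prime[OF qA(1)] by auto
      ultimately obtain x y where "p * x = q * y + 1"
        using coprime_bezout_strong[of p q] by blast
      then have "(z ^ p) ^ x = (z ^ q) ^ y * z"
        by (metis power_add power_mult power_one_right)
      then show False using pole q by simp
    qed
    \<comment> \<open>Every product except the one omitting \<open>p\<close> contains the vanishing
      factor of \<open>p\<close>, so a single summand survives.\<close>
    have "(\<Sum>r\<in>A - {p}. \<Prod>q\<in>A - {r}. ?S q z) = 0"
    proof (rule sum.neutral, rule ballI, rule prod_zero)
      fix r assume "r \<in> A - {p}"
      then show "\<exists>q\<in>A - {r}. ?S q z = 0"
        using pole by (intro bexI[of _ p]) (auto simp: S)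
    qed (use fin in auto)
    then have "(\<Sum>r\<in>A. \<Prod>q\<in>A - {r}. ?S q z) = (\<Prod>q\<in>A - {p}. ?S q z)"
      using fin pole by (simp add: sum.remove[of A p])
    moreover have "(\<Prod>q\<in>A. ?S q z) = 0"
      using fin pole by (auto simp: S)
    ultimately have "poly (map_poly of_int (star_poly A)) z = - (\<Prod>q\<in>A - {p}. ?S q z)"
      by (simp add: poly_star_poly)
    moreover have "(\<Prod>q\<in>A - {p}. ?S q z) \<noteq> 0"
      using fin zq pole by (auto simp: S)
    ultimately show ?thesis by simp
  next
    case reg
    have "Re (star_fun A z) = 0"
      using reg z by (simp add: star_fun_def Re_star_fun_term norm_power del: plus_complex.sel)
    moreover have "Re z \<noteq> 1"
      using z reg(1) by (auto simp: cmod_def complex_eq_iff)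
    ultimately have "z - 1 - star_fun A z \<noteq> 0" by (auto simp: complex_eq_iff)
    moreover have "(\<Prod>p\<in>A. ?S p z) \<noteq> 0"
      using fin reg by (auto simp: geometric_sum)
    ultimately show ?thesis
      using reg by (simp add: star_poly_factor[OF fin ev])
  qed
qed

section \<open>The root outside the unit circle\<close>

lemma star_poly_root_iff:
  fixes z :: complex
  assumes "finite A" "even (card A)" "\<And>p. p \<in> A \<Longrightarrow> p > 0" "cmod z > 1"
  shows "poly (map_poly of_int (star_poly A)) z = 0 \<longleftrightarrow> z = 1 + star_fun A z"
proof -
  have z: "z ^ p \<noteq> 1" if "p \<in> A" for p
    using one_less_power[OF assms(4) assms(3)[OF that]] by (metis norm_one norm_power less_irrefl)
  have "z \<noteq> 1" using assms(4) by auto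
  then have "(\<Prod>p\<in>A. \<Sum>k<p. z ^ k) \<noteq> 0"
    using assms(1) z by (auto simp: geometric_sum)
  then show ?thesis
    using \<open>z \<noteq> 1\<close> z by (simp add: star_poly_factor[OF assms(1,2)] diff_eq_eq add.commute)
qed

text \<open>With \<open>u = 1/z\<close> the equation \<open>z = 1 + star_fun A z\<close> becomes a fixed-point equation
  for a holomorphic self-map of the disc that does not fix the origin.\<close>

lemma star_poly_root_outside_unique:
  fixes a b :: complex
  assumes fin: "finite A" and ev: "even (card A)" and ne: "A \<noteq> {}" and pos: "\<And>p. p \<in> A \<Longrightarrow> p > 0"
    and a: "cmod a > 1" "poly (map_poly of_int (star_poly A)) a = 0"
    and b: "cmod b > 1" "poly (map_poly of_int (star_poly A)) b = 0"
  shows "a = b"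
proof (rule ccontr)
  assume "a \<noteq> b"
  \<comment> \<open>Writing \<open>1 / (z ^ p - 1)\<close> in terms of \<open>u = 1 / z\<close>
    removes the singularity at \<open>u = 0\<close>, the image of infinity.\<close>
  define K where "K u = (\<Sum>p\<in>A. 1 / 2 + u ^ p / (1 - u ^ p))" for u :: complex
  define f where "f u = 1 / (1 + K u)" for u
  have up: "u ^ p \<noteq> 1" if "cmod u < 1" "p \<in> A" for u p
    using power_Suc_less_one[of "cmod u" "p - 1"] pos[OF that(2)] that(1)
    by (metis norm_ge_zero norm_one norm_power Suc_diff_1 less_irrefl power_less_one_iff)
  have K_inv: "K (1 / z) = star_fun A z" if "cmod z > 1" for z
  proof -
    have "1 / 2 + (1 / z) ^ p / (1 - (1 / z) ^ p) = 1 / 2 + 1 / (z ^ p - 1)" if "p \<in> A" for p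
      using up[of "1 / z" p] that \<open>cmod z > 1\<close> by (auto simp: divide_simps norm_divide)
    then show ?thesis by (simp add: K_def star_fun_def)
  qed
  have K0: "K 0 = of_nat (card A) / 2"
  proof -
    have "K 0 = (\<Sum>p\<in>A. 1 / 2)"
      unfolding K_def using pos by (intro sum.cong) auto
    then show ?thesis by simp
  qed
  have ReK: "Re (K u) > 0" if "cmod u < 1" for u
  proof (cases "u = 0")
    case True
    then show ?thesis using fin ne by (simp add: K0 card_gt_0_iff)
  next
    case False
    then have "cmod (1 / u) > 1" using that by (simp add: norm_divide)
    then show ?thesis using K_inv[of "1 / u"] Re_star_fun_pos[OF fin ne pos] by simp
  qed
  have big: "cmod (1 + K u) > 1" if "cmod u < 1" for u
    using ReK[OF that] complex_Re_le_cmod[of "1 + K u"] by simp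
  have "K holomorphic_on ball 0 1"
    unfolding K_def using up by (intro holomorphic_intros) auto
  then have "f holomorphic_on ball 0 1"
    unfolding f_def using big by (intro holomorphic_intros) force+
  moreover have "cmod (f u) < 1" if "cmod u < 1" for u
    using big[OF that] by (simp add: f_def norm_divide divide_less_eq)
  moreover have "f (1 / z) = 1 / z"
    if "cmod z > 1" "poly (map_poly of_int (star_poly A)) z = 0" for z
    using that star_poly_root_iff[OF fin ev pos] by (simp add: f_def K_inv)
  moreover have "cmod (1 / a) < 1" "cmod (1 / b) < 1" "1 / a \<noteq> 1 / b"
    using a(1) b(1) \<open>a \<noteq> b\<close> by (auto simp: norm_divide divide_less_eq)
  \<comment> \<open>Two fixed points would make \<open>f\<close> the identity, yet as a reciprocal
    it does not vanish at 0.\<close>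
  ultimately have "f 0 = 0"
    using two_fixed_points_imp_id[of f "1 / a" "1 / b" 0] a b by simp
  then show False using big[of 0] by (simp add: f_def)
qed

text \<open>A root of modulus at least 1 exists and is not on the circle. Its complex conjugate is
  also a root, so uniqueness makes it real.\<close>

lemma star_poly_ex_root:
  assumes fin: "finite A" and ev: "even (card A)" and card: "card A > 2"
    and prime: "\<And>p. p \<in> A \<Longrightarrow> prime p"
  obtains \<theta> :: real where "\<theta> > 1" "poly (map_poly of_int (star_poly A)) \<theta> = 0"
proof -
  have pos: "p > 0" and ge2: "p \<ge> 2" if "p \<in> A" for p
    using prime[OF that] by (auto simp: prime_gt_0_nat prime_ge_2_nat)
  have ne: "A \<noteq> {}" using card by auto
  let ?F = "map_poly of_int (star_poly A) :: complex poly"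
  have "coeff (star_poly A) 0 \<noteq> 0"
    using card ev by (auto simp: coeff_0_star_poly[OF pos] elim!: evenE)
  then obtain z :: complex where z: "poly ?F z = 0" "cmod z \<ge> 1"
    using ex_root_norm_ge_1[of "star_poly A"] star_poly_degree_coeff[OF fin ge2] by auto
  then have z1: "cmod z > 1"
    using star_poly_no_root_on_circle[OF fin ev ne prime, of z] by fastforce
  have "poly ?F (cnj z) = cnj (poly ?F z)"
    by (simp add: poly_altdef coeff_map_poly)
  then have "cnj z = z"
    using star_poly_root_outside_unique[OF fin ev ne pos, of "cnj z" z] z z1 by simp
  then have real: "z = of_real (Re z)" by (simp add: complex_eq_iff)
  have "z = 1 + star_fun A z" using star_poly_root_iff[OF fin ev pos z1] z by simp
  \<comment> \<open>Positivity of the real part of \<open>star_fun\<close> excludes a real root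
    below -1.\<close>
  then have "Re z > 1"
    using Re_star_fun_pos[OF fin ne pos z1] by (metis less_add_same_cancel1 one_complex.sel(1) plus_complex.sel(1))
  moreover have "poly (map_poly of_int (star_poly A)) (Re z) = 0"
    using z(1) real poly_map_poly_of_int_of_real[of "star_poly A" "Re z"]
    by (metis of_real_eq_0_iff)
  ultimately show ?thesis by (rule that)
qed

text \<open>\<open>star_fun A\<close> decreases on the real axis to the right of 1, so \<open>x - 1 - star_fun A x\<close>
  grows at least like \<open>x - \<theta>\<close>.\<close>

lemma star_poly_simple_root:
  fixes \<theta> :: real
  assumes fin: "finite A" and ev: "even (card A)" and pos: "\<And>p. p \<in> A \<Longrightarrow> p > 0"
    and \<theta>: "\<theta> > 1" and root: "poly (map_poly of_int (star_poly A)) \<theta> = 0"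
  shows "poly (pderiv (map_poly of_int (star_poly A))) \<theta> \<noteq> 0"
proof -
  let ?F = "map_poly of_int (star_poly A) :: real poly"
  have S: "(\<Prod>p\<in>A. \<Sum>k<p. x ^ k) \<ge> 1" if "x > 1" for x :: real
  proof (rule prod_ge_1)
    fix p assume "p \<in> A"
    then have "(\<Sum>k\<in>{0}. x ^ k) \<le> (\<Sum>k<p. x ^ k)"
      using pos that by (intro sum_mono2) auto
    then show "1 \<le> (\<Sum>k<p. x ^ k)" by simp
  qed
  have xp: "x ^ p > 1" if "x > 1" "p \<in> A" for x :: real and p
    using that pos by (simp add: one_less_power)
  have factor: "poly ?F x = (x - 1) * (\<Prod>p\<in>A. \<Sum>k<p. x ^ k) * (x - 1 - star_fun A x)"
    if "x > 1" for x
    using that xp[OF that] by (intro star_poly_factor fin ev) force+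
  have \<theta>_eq: "\<theta> - 1 = star_fun A \<theta>"
    using root S[OF \<theta>] \<theta> by (auto simp: factor[OF \<theta>])
  have quot: "(poly ?F x - poly ?F \<theta>) / (x - \<theta>) \<ge> \<theta> - 1" if "x > \<theta>" for x
  proof -
    have x: "x > 1" using that \<theta> by simp
    have "star_fun A x \<le> star_fun A \<theta>"
      unfolding star_fun_def
    proof (intro sum_mono add_left_mono divide_left_mono)
      fix p assume "p \<in> A"
      then show "\<theta> ^ p - 1 \<le> x ^ p - 1" "0 < (x ^ p - 1) * (\<theta> ^ p - 1)"
        using xp[OF x] xp[OF \<theta>] that \<theta> by (auto intro: power_mono)
    qed auto
    then have 1: "x - 1 - star_fun A x \<ge> x - \<theta>" using \<theta>_eq by simp
    have 2: "(x - 1) * (\<Prod>p\<in>A. \<Sum>k<p. x ^ k) \<ge> (\<theta> - 1) * 1"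
      using S[OF x] that \<theta> by (intro mult_mono) auto
    have 3: "0 \<le> (x - 1) * (\<Prod>p\<in>A. \<Sum>k<p. x ^ k)"
      using S[OF x] x by (intro mult_nonneg_nonneg) auto
    have "poly ?F x \<ge> (\<theta> - 1) * 1 * (x - \<theta>)"
      unfolding factor[OF x] by (rule mult_mono[OF 2 1 3]) (use that in simp)
    then show ?thesis using root that by (simp add: pos_le_divide_eq)
  qed
  \<comment> \<open>The quotient is bounded only for \<open>x > \<theta>\<close>, so the derivative
    is taken as a limit from the right.\<close>
  have "(poly ?F has_real_derivative poly (pderiv ?F) \<theta>) (at_right \<theta>)"
    by (rule has_field_derivative_at_within[OF poly_DERIV])
  then have "((\<lambda>x. (poly ?F x - poly ?F \<theta>) / (x - \<theta>)) \<longlongrightarrow> poly (pderiv ?F) \<theta>) (at_right \<theta>)"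
    by (simp add: has_field_derivative_iff)
  then have "\<theta> - 1 \<le> poly (pderiv ?F) \<theta>"
    by (rule tendsto_lowerbound)
       (auto intro!: eventually_mono[OF eventually_at_right_less[of \<theta>]] quot)
  then show ?thesis using \<theta> by simp
qed

theorem theorem2:
  fixes T :: int
  assumes "T \<ge> 1"
  shows "\<exists>\<theta> :: real. pisot \<theta> \<and> alg_trace \<theta> = of_int (- T) \<and>
           alg_degree \<theta> \<le> (\<Sum>i < nat (2 * T + 4). enumerate {p :: nat. prime p} i)"
proof -
  let ?e = "enumerate {p :: nat. prime p}" and ?n = "nat (2 * T + 4)"
  \<comment> \<open>With \<open>2 * T + 4 = 2 * m\<close> primes, \<open>m = T + 2\<close>, and the
    trace \<open>2 - m\<close> becomes \<open>- T\<close>.\<close>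
  define A where "A = ?e ` {..<?n}"
  have inf: "infinite {p :: nat. prime p}" by (rule primes_infinite)
  have inj: "inj_on ?e {..<?n}" using inj_enumerate[OF inf] by (rule inj_on_subset) auto
  have fin: "finite A" by (simp add: A_def)
  have prime: "prime p" if "p \<in> A" for p
    using that enumerate_in_set[OF inf] by (auto simp: A_def)
  have pos: "p > 0" and ge2: "p \<ge> 2" if "p \<in> A" for p
    using prime[OF that] by (auto simp: prime_gt_0_nat prime_ge_2_nat)
  have card: "card A = ?n" using inj by (simp add: A_def card_image)
  then have half: "card A = 2 * nat (T + 2)" using assms by simp
  then have ev: "even (card A)" and card2: "card A > 2" and ne: "A \<noteq> {}"
    using assms by auto
  obtain \<theta> :: real where \<theta>: "\<theta> > 1" "poly (map_poly of_int (star_poly A)) \<theta> = 0"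
    by (rule star_poly_ex_root[OF fin ev card2 prime])
  have root: "poly (map_poly of_int (star_poly A)) (of_real \<theta> :: complex) = 0"
    using \<theta>(2) by (simp add: poly_map_poly_of_int_of_real)
  have others: "z = of_real \<theta> \<or> cmod z < 1" if "poly (map_poly of_int (star_poly A)) z = 0" for z
    using star_poly_no_root_on_circle[OF fin ev ne prime, of z]
      star_poly_root_outside_unique[OF fin ev ne pos, of z "of_real \<theta>"] that root \<theta>(1)
    by fastforce
  note deg = star_poly_degree_coeff(1)[OF fin ge2, simplified]
    and lead = star_poly_degree_coeff(2)[OF fin ge2, simplified]
    and second = star_poly_degree_coeff(3)[OF fin ge2, simplified]
  have f0: "coeff (star_poly A) 0 \<noteq> 0"
    using half assms by (simp add: coeff_0_star_poly[OF pos])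
  have simple: "poly (pderiv (map_poly of_int (star_poly A))) \<theta> \<noteq> 0"
    by (rule star_poly_simple_root[OF fin ev pos \<theta>])
  have pisot: "pisot \<theta>" and mp: "min_poly \<theta> = map_poly of_int (star_poly A)"
    by (rule pisot_criterion[OF lead f0 \<theta> simple], erule others)+
  have "alg_trace \<theta> = - coeff (reflect_poly (map_poly of_int (star_poly A))) 1"
    unfolding alg_trace_def mp map_poly_of_rat_of_int
    using lead by (intro sum_proots) (simp add: coeff_map_poly)
  also have "\<dots> = - of_int (coeff (reflect_poly (star_poly A)) 1)"
    by (simp add: coeff_reflect_poly coeff_map_poly)
  also have "\<dots> = of_int (- T)"
    using assms by (simp add: second half)
  finally have "alg_trace \<theta> = of_int (- T)" .
  moreover have "alg_degree \<theta> \<le> (\<Sum>i < ?n. ?e i)"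
  proof -
    \<comment> \<open>The degree is 2 plus the sum of the primes minus \<open>card A\<close>, so
      \<open>card A > 2\<close> gives the bound.\<close>
    have "(\<Sum>p\<in>A. p - 1) + card A = (\<Sum>p\<in>A. (p - 1) + 1)"
      by (subst sum.distrib) simp
    also have "\<dots> = (\<Sum>p\<in>A. p)" using pos by (intro sum.cong) auto
    also have "\<dots> = (\<Sum>i < ?n. ?e i)" using inj by (simp add: A_def sum.reindex)
    finally show ?thesis
      using card2 by (simp add: alg_degree_def mp deg)
  qed
  ultimately show ?thesis using pisot by blast
qed

end
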